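(* Let $\ell\geq 2$ and let $\mathbb{C}=(\mathcal{C}_1,\mathcal{C}_2,\ldots,\mathcal{C}_\ell)$ be a colour cluster with $|\mathcal{C}_i|=r_i>0$ for $1\leq i\leq \ell$. Then the minimum number of edges of a connected graph that allows $\mathbb{C}$ as a proper colouring is $\sum_{i=1}^{\ell} r_i-1$; that is, there is a connected graph with $\sum_{i=1}^{\ell} r_i-1$ edges allowing $\mathbb{C}$ as a proper colouring, and no connected graph allowing $\mathbb{C}$ as a proper colouring has fewer edges.
   Context: All graphs are finite, simple and undirected. A colour cluster $\mathbb{C}=(\mathcal{C}_1,\ldots,\mathcal{C}_\ell)$ is a finite list of colour classes, where $\mathcal{C}_i$ consists of $r_i=|\mathcal{C}_i|\geq 1$ copies of the colour $c_i$, and the colours $c_1,\ldots,c_\ell$ are distinct. A graph $G$ allows $\mathbb{C}$ as a proper colouring if $G$ has exactly $\sum_{i=1}^{\ell} r_i$ vertices and there is a proper vertex colouring of $G$ (adjacent vertices receive different colours) with colours $c_1,\ldots,c_\ell$ in which colour $c_i$ is used on exactly $r_i$ vertices for each $i$. It is not required that $\ell$ equal the chromatic number of $G$. *)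

theory Defs
  imports "Graph_Theory.Graph_Theory"
begin

text \<open>
  A finite simple undirected graph is a \<open>pair_graph\<close>: a finite, loop-free, symmetric digraph whose
  arcs are ordered pairs of vertices. Each undirected edge is represented by two opposite arcs, so
  edges have to be counted as unordered pairs.
\<close>

definition uedges :: "'v pair_pre_digraph \<Rightarrow> 'v set set" where
  "uedges G = {{u, v} | u v. (u, v) \<in> parcs G}"

text \<open>
  The entry \<open>(c\<^sub>i, r\<^sub>i)\<close> of the list stands for the colour class consisting of \<open>r\<^sub>i\<close> copies of the
  colour \<open>c\<^sub>i\<close>.
\<close>

type_synonym 'c colour_cluster = "('c \<times> nat) list"

definition colour_cluster :: "'c colour_cluster \<Rightarrow> bool" where
  "colour_cluster C \<longleftrightarrow> distinct (map fst C) \<and> (\<forall>(c, r) \<in> set C. r \<ge> 1)"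

definition cluster_size :: "'c colour_cluster \<Rightarrow> nat" where
  "cluster_size C = (\<Sum>(c, r) \<leftarrow> C. r)"

definition proper_colouring :: "'v pair_pre_digraph \<Rightarrow> ('v \<Rightarrow> 'c) \<Rightarrow> bool" where
  "proper_colouring G f \<longleftrightarrow> (\<forall>(u, v) \<in> parcs G. f u \<noteq> f v)"

definition allows_cluster :: "'v pair_pre_digraph \<Rightarrow> 'c colour_cluster \<Rightarrow> bool" where
  "allows_cluster G C \<longleftrightarrow>
     card (pverts G) = cluster_size C \<and>
     (\<exists>f. proper_colouring G f \<and>
          f ` pverts G \<subseteq> fst ` set C \<and>
          (\<forall>(c, r) \<in> set C. card {v \<in> pverts G. f v = c} = r))"

end

theory Submission
  imports Defs
begin

text \<open>
  Lower bound. Root a connected graph at a vertex \<open>r\<close> and send every other vertex \<open>v\<close> to the edge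
  that joins it to its predecessor on a shortest path from \<open>r\<close>. The endpoint of this edge that lies
  further from \<open>r\<close> is \<open>v\<close>, so different vertices get different edges, and there are at least as many
  edges as vertices other than \<open>r\<close> (lemma \<open>connected_card_uedges_ge\<close>).

  Attaining it. Give finitely many vertices the colours prescribed by the cluster. Since there
  are at least two classes, there are vertices \<open>a\<close> and \<open>b\<close> of different colours. Join \<open>a\<close> to every
  vertex whose colour is not that of \<open>a\<close>, and join \<open>b\<close> to the remaining vertices other than \<open>a\<close>. This
  double star is connected and properly coloured, and it has one edge for each vertex other
  than \<open>a\<close> (lemma \<open>double_star_exists\<close>).
\<close>

text \<open>
  The library defines connectedness through the symmetric closure, which changes nothing
  when the arc set is already symmetric.
\<close>

lemma pair_graph_connected_iff:
  assumes "pair_graph G"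
  shows "connected (with_proj G) \<longleftrightarrow>
    pverts G \<noteq> {} \<and> (\<forall>u \<in> pverts G. \<forall>v \<in> pverts G. (u, v) \<in> (parcs G)\<^sup>*)"
proof -
  interpret pair_graph G by (rule assms)
  have "sym (parcs G)"
    using pair_sym_arcs by (simp add: symmetric_def)
  then have "mk_symmetric (with_proj G) = G"
    by (auto simp: mk_symmetric_def sym_def intro!: pair_pre_digraph.equality)
  moreover have "u \<rightarrow>\<^sup>*\<^bsub>with_proj G\<^esub> v \<longleftrightarrow> (u, v) \<in> (parcs G)\<^sup>*"
    if "u \<in> pverts G" "v \<in> pverts G" for u v
    using that
    by (fastforce simp: reachable_def intro: rtrancl_consistent_rtrancl_on rtrancl_on_rtranclI
        dest: arc_snd_in_verts)
  ultimately show ?thesis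
    by (auto simp: connected_def strongly_connected_def)
qed

lemma finite_uedges:
  assumes "finite (parcs G)"
  shows "finite (uedges G)"
proof -
  have "uedges G = (\<lambda>(u, v). {u, v}) ` parcs G"
    by (auto simp: uedges_def)
  with assms show ?thesis by simp
qed

text \<open>
  The parent is the predecessor on a shortest path from \<open>r\<close>, and the depth is the distance from \<open>r\<close>.
\<close>

lemma bfs_parent_exists:
  assumes reach: "\<And>v. v \<in> V \<Longrightarrow> (r, v) \<in> R\<^sup>*"
  obtains parent and depth :: "'v \<Rightarrow> nat"
  where "\<And>v. v \<in> V - {r} \<Longrightarrow> (parent v, v) \<in> R \<and> depth (parent v) < depth v"
proof -
  define depth where "depth v = (LEAST n. (r, v) \<in> R ^^ n)" for v
  have "\<exists>u. (u, v) \<in> R \<and> depth u < depth v" if v: "v \<in> V - {r}" for v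
  proof -
    from reach v obtain n where "(r, v) \<in> R ^^ n"
      by (auto dest: rtrancl_imp_relpow)
    then have walk: "(r, v) \<in> R ^^ depth v"
      unfolding depth_def by (rule LeastI)
    with v have "depth v \<noteq> 0"
      by (auto intro: ccontr)
    then obtain k where k: "depth v = Suc k"
      by (auto simp: gr0_conv_Suc)
    with walk obtain u where u: "(r, u) \<in> R ^^ k" "(u, v) \<in> R"
      by auto
    have "depth u \<le> k"
      unfolding depth_def using u(1) by (rule Least_le)
    with u(2) k show ?thesis by auto
  qed
  then show thesis using that by metis
qed

text \<open>
  Depth recovers \<open>v\<close> from the edge \<open>{parent v, v}\<close>: it is the deeper endpoint.
\<close>

lemma inj_on_parent_edge:
  fixes depth :: "'v \<Rightarrow> nat"
  assumes "\<And>v. v \<in> A \<Longrightarrow> depth (parent v) < depth v"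
  shows "inj_on (\<lambda>v. {parent v, v}) A"
  using assms by (intro inj_onI) (metis doubleton_eq_iff order_less_asym)

lemma connected_card_uedges_ge:
  assumes "pair_graph G" and conn: "connected (with_proj G)"
  shows "card (pverts G) - 1 \<le> card (uedges G)"
proof -
  interpret pair_graph G by fact
  obtain r where r: "r \<in> pverts G"
    and reach: "\<And>v. v \<in> pverts G \<Longrightarrow> (r, v) \<in> (parcs G)\<^sup>*"
    using conn pair_graph_connected_iff[OF assms(1)] by blast
  obtain parent and depth :: "'a \<Rightarrow> nat"
    where parent: "\<And>v. v \<in> pverts G - {r} \<Longrightarrow>
      (parent v, v) \<in> parcs G \<and> depth (parent v) < depth v"
    using bfs_parent_exists[OF reach] by blast
  have "card (pverts G - {r}) \<le> card (uedges G)"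
  proof (rule card_inj_on_le)
    show "inj_on (\<lambda>v. {parent v, v}) (pverts G - {r})"
      using parent by (intro inj_on_parent_edge[where depth = depth]) blast
    show "(\<lambda>v. {parent v, v}) ` (pverts G - {r}) \<subseteq> uedges G"
      using parent by (auto simp: uedges_def)
    show "finite (uedges G)"
      using pair_finite_arcs by (rule finite_uedges)
  qed
  with r show ?thesis by simp
qed

text \<open>
  The tree is given by a parent map with root \<open>a\<close>: vertices coloured like \<open>a\<close> hang from \<open>b\<close>, all
  others, among them \<open>b\<close>, from \<open>a\<close>. Hence \<open>a\<close> is reached in at most two steps. Only the upper bound
  on the number of edges has to be read off the construction, since connectedness
  gives the other one.
\<close>

lemma double_star_exists:
  fixes f :: "'v \<Rightarrow> 'c"
  assumes fin: "finite V" and a: "a \<in> V" and b: "b \<in> V" and ab: "f a \<noteq> f b"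
  obtains G where "pair_graph G" "pverts G = V" "connected (with_proj G)"
    "proper_colouring G f" "card (uedges G) = card V - 1"
proof -
  define parent where "parent v = (if f v = f a then b else a)" for v
  define P where "P = (\<lambda>v. (v, parent v)) ` (V - {a})"
  define G where "G = \<lparr>pverts = V, parcs = P \<union> P\<inverse>\<rparr>"
  have parent_V: "parent v \<in> V" for v
    using a b by (simp add: parent_def)
  have parent_colour: "f (parent v) \<noteq> f v" for v
    using ab by (auto simp: parent_def)
  have P_V: "P \<subseteq> V \<times> V"
    using parent_V by (auto simp: P_def)
  have P_colour: "f u \<noteq> f v" if "(u, v) \<in> P" for u v
    using that parent_colour[of u] by (auto simp: P_def)
  have G: "pair_graph G"
  proof
    show "finite (pverts G)" "finite (parcs G)"
      using fin by (auto simp: G_def P_def)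
    show "fst e \<in> pverts G" "snd e \<in> pverts G" if "e \<in> parcs G" for e
      using that P_V by (auto simp: G_def)
    show "fst e \<noteq> snd e" if "e \<in> parcs G" for e
      using that by (cases e) (auto simp: G_def dest: P_colour)
    show "symmetric (with_proj G)"
      by (auto simp: symmetric_def G_def intro: symI)
  qed
  have to_root: "(v, a) \<in> P\<^sup>*" if v: "v \<in> V" for v
  proof -
    have step: "(u, parent u) \<in> P\<^sup>*" if "u \<in> V" "u \<noteq> a" for u
      using that by (auto simp: P_def)
    have "(b, a) \<in> P\<^sup>*"
      using step[OF b] ab by (auto simp: parent_def)
    then show ?thesis
      using step[OF v] by (cases "v = a"; cases "f v = f a") (auto simp: parent_def intro: rtrancl_trans)
  qed
  have conn: "connected (with_proj G)"
    unfolding pair_graph_connected_iff[OF G]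
  proof (intro conjI ballI)
    show "pverts G \<noteq> {}"
      using a by (auto simp: G_def)
    fix u v
    assume "u \<in> pverts G" "v \<in> pverts G"
    then have "(u, a) \<in> P\<^sup>*" and "(a, v) \<in> (P\<inverse>)\<^sup>*"
      using to_root by (auto simp: G_def rtrancl_converse)
    then have "(u, a) \<in> (P \<union> P\<inverse>)\<^sup>*" and "(a, v) \<in> (P \<union> P\<inverse>)\<^sup>*"
      by (meson in_rtrancl_UnI)+
    then show "(u, v) \<in> (parcs G)\<^sup>*"
      by (simp add: G_def)
  qed
  have "uedges G \<subseteq> (\<lambda>v. {v, parent v}) ` (V - {a})"
    by (auto simp: uedges_def G_def P_def)
  then have "card (uedges G) \<le> card (V - {a})"
    using fin by (intro surj_card_le) auto
  with connected_card_uedges_ge[OF G conn] a have "card (uedges G) = card V - 1"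
    by (simp add: G_def)
  moreover have "proper_colouring G f"
    by (auto simp: proper_colouring_def G_def dest: P_colour)
  ultimately show thesis
    using that[of G] G conn by (simp add: G_def)
qed

lemma count_list_colours:
  assumes "distinct (map fst C)" and "(c, r) \<in> set C"
  shows "count_list (concat (map (\<lambda>(c, r). replicate r c) C)) c = r"
  using assms
proof (induction C)
  case (Cons x C)
  obtain d s where x: "x = (d, s)"
    by force
  have rep: "count_list (replicate s d) c = (if d = c then s else 0)"
    by (induction s) auto
  show ?case
  proof (cases "d = c")
    case True
    with Cons.prems x have notin: "c \<notin> fst ` set C" and "r = s"
      by (auto simp: image_iff)
    from notin have "count_list (concat (map (\<lambda>(c, r). replicate r c) C)) c = 0"
      by (force simp: count_list_0_iff)
    with rep True x \<open>r = s\<close> show ?thesis by simp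
  next
    case False
    with Cons rep x show ?thesis by auto
  qed
qed simp

text \<open>
  Listing every colour as often as its class prescribes gives \<open>cluster_size C\<close> entries, and
  vertex \<open>i\<close> receives the \<open>i\<close>-th one.
\<close>

lemma cluster_realised:
  assumes "colour_cluster C"
  obtains f where "f ` {..<cluster_size C} \<subseteq> fst ` set C"
    "\<And>c r. (c, r) \<in> set C \<Longrightarrow> card {v \<in> {..<cluster_size C}. f v = c} = r"
proof -
  define xs where "xs = concat (map (\<lambda>(c, r). replicate r c) C)"
  have len: "length xs = cluster_size C"
    unfolding xs_def cluster_size_def by (induction C) auto
  have "(!) xs ` {..<cluster_size C} \<subseteq> set xs"
    by (auto simp: len[symmetric])
  also have "\<dots> \<subseteq> fst ` set C"
    by (force simp: xs_def)
  finally have "(!) xs ` {..<cluster_size C} \<subseteq> fst ` set C" .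
  moreover have "card {v \<in> {..<cluster_size C}. xs ! v = c} = r" if "(c, r) \<in> set C" for c r
  proof -
    have "card {v \<in> {..<cluster_size C}. xs ! v = c} = count_list xs c"
      by (simp add: count_list_eq_length_filter length_filter_conv_card len eq_commute)
    also have "\<dots> = r"
      using assms that unfolding xs_def by (intro count_list_colours) (auto simp: colour_cluster_def)
    finally show ?thesis .
  qed
  ultimately show thesis by (rule that)
qed

theorem lemma2p1:
  fixes C :: "'c colour_cluster"
  assumes "colour_cluster C" and "length C \<ge> 2"
  shows "(\<exists>G :: nat pair_pre_digraph.
            pair_graph G \<and> connected (with_proj G) \<and> allows_cluster G C \<and>
            card (uedges G) = cluster_size C - 1) \<and>
         (\<forall>G :: 'v pair_pre_digraph.
            pair_graph G \<and> connected (with_proj G) \<and> allows_cluster G C \<longrightarrow>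
            cluster_size C - 1 \<le> card (uedges G))"
proof (intro conjI allI impI)
  let ?V = "{..<cluster_size C}"
  obtain f where f: "f ` ?V \<subseteq> fst ` set C"
    "\<And>c r. (c, r) \<in> set C \<Longrightarrow> card {v \<in> ?V. f v = c} = r"
    using cluster_realised[OF assms(1)] by blast
  have used: "\<exists>v \<in> ?V. f v = fst x" if "x \<in> set C" for x
  proof -
    have "snd x \<ge> 1"
      using assms(1) that by (auto simp: colour_cluster_def)
    then have "card {v \<in> ?V. f v = fst x} \<noteq> 0"
      using f(2)[of "fst x" "snd x"] that by simp
    then show ?thesis
      by (metis (mono_tags, lifting) Collect_empty_eq card.empty)
  qed
  have "map fst C ! 0 \<noteq> map fst C ! 1"
    using assms by (subst nth_eq_iff_index_eq) (auto simp: colour_cluster_def)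
  moreover have "C ! 0 \<in> set C" "C ! 1 \<in> set C"
    using assms(2) by (auto intro!: nth_mem)
  moreover have "0 < length C" "1 < length C"
    using assms(2) by auto
  ultimately obtain a b where "a \<in> ?V" "b \<in> ?V" "f a \<noteq> f b"
    using used by (metis nth_map)
  then obtain G where "pair_graph G" "connected (with_proj G)" "card (uedges G) = card ?V - 1"
    and G: "pverts G = ?V" "proper_colouring G f"
    using double_star_exists[of ?V a b f] by blast
  moreover have "allows_cluster G C"
    unfolding allows_cluster_def
  proof (intro conjI exI[of _ f])
    show "\<forall>(c, r) \<in> set C. card {v \<in> pverts G. f v = c} = r"
      using f(2) G(1) by auto
  qed (use f(1) G in simp_all)
  ultimately show "\<exists>G :: nat pair_pre_digraph.
      pair_graph G \<and> connected (with_proj G) \<and> allows_cluster G C \<and>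
      card (uedges G) = cluster_size C - 1"
    by auto
next
  fix G :: "'v pair_pre_digraph"
  assume "pair_graph G \<and> connected (with_proj G) \<and> allows_cluster G C"
  then show "cluster_size C - 1 \<le> card (uedges G)"
    using connected_card_uedges_ge[of G] by (simp add: allows_cluster_def)
qed

end
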